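(* Let $m,n\ge 1$, let $\mathcal{G}=([m],E)$ be an undirected graph, and let $G=\{g\in \mathrm{GL}_m(\mathbb{R}) \mid g\cdot \mathcal{S}^+_{\mathcal{G}}\subseteq \mathcal{S}^+_{\mathcal{G}}\}$. There exists a $G$-equivariant estimator $T:\mathbb{R}^{m\times n}\to\mathcal{S}^+_{\mathcal{G}}$ if and only if $n\ge \max_{i\in[m]}|{\downarrow} i|$. More precisely: (1) if $n\ge \max_{i\in[m]}|{\downarrow} i|$, then there exist a $G$-stable proper real algebraic subset $Z\subsetneq\mathbb{R}^{m\times n}$ and a map $T:\mathbb{R}^{m\times n}\setminus Z\to\mathcal{S}^+_{\mathcal{G}}$ such that $T(g\mathbf{x})=g\cdot T(\mathbf{x})$ for all $g\in G$ and all $\mathbf{x}\in\mathbb{R}^{m\times n}\setminus Z$; (2) if $n< \max_{i\in[m]}|{\downarrow} i|$, then there is no nonempty $G$-stable subset $U\subseteq\mathbb{R}^{m\times n}$ admitting a map $T:U\to\mathcal{S}^+_{\mathcal{G}}$ with $T(g\mathbf{x})=g\cdot T(\mathbf{x})$ for all $g\in G$ and $\mathbf{x}\in U$.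
   Context: Graphs are finite and simple, $[m]=\{1,\dots,m\}$, and $E$ is a set of two-element subsets of $[m]$. $\mathcal{S}_{\mathcal{G}}$ is the linear space of real symmetric $m\times m$ matrices whose $(i,j)$ entry is zero whenever $i\ne j$ and $\{i,j\}\notin E$; $\mathcal{S}^+_{\mathcal{G}}$ is the set of positive definite matrices in $\mathcal{S}_{\mathcal{G}}$. The group $\mathrm{GL}_m(\mathbb{R})$ acts on real symmetric $m\times m$ matrices by $g\cdot K=g^{-T}Kg^{-1}$, and on $\mathbb{R}^{m\times n}$ (matrices whose $n$ columns are the sample points) by left multiplication; $G$ is a subgroup. Writing $N(i)=\{j\in[m] : \{i,j\}\in E\}$, the pre-order $\preccurlyeq$ on $[m]$ is defined by $i\preccurlyeq j$ if and only if $N(j)\cup\{j\}\subseteq N(i)\cup\{i\}$, and ${\downarrow} i=\{j\in[m] : j\preccurlyeq i\}$. A real algebraic subset is the common zero set of a family of real polynomials in the matrix entries. *)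

theory Defs
  imports "HOL-Analysis.Analysis"
begin

text \<open>
  The vertex set is the finite type \<open>'m\<close> and the sample index set is the finite type \<open>'n\<close>,
  so that \<open>m = CARD('m)\<close> and \<open>n = CARD('n)\<close>.  A sample is a matrix of type \<open>real^'n^'m\<close>,
  with \<open>m\<close> rows and \<open>n\<close> columns.
\<close>

definition simple_graph :: "'m set set \<Rightarrow> bool" where
  "simple_graph E \<longleftrightarrow> (\<forall>e\<in>E. card e = 2)"

definition neighbours :: "'m set set \<Rightarrow> 'm \<Rightarrow> 'm set" where
  "neighbours E i = {j. {i, j} \<in> E}"

definition graph_preorder :: "'m set set \<Rightarrow> 'm \<Rightarrow> 'm \<Rightarrow> bool" where
  "graph_preorder E i j \<longleftrightarrow> neighbours E j \<union> {j} \<subseteq> neighbours E i \<union> {i}"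

definition down_set :: "'m set set \<Rightarrow> 'm \<Rightarrow> 'm set" where
  "down_set E i = {j. graph_preorder E j i}"

definition graph_matrices :: "'m set set \<Rightarrow> (real^'m^'m) set" where
  "graph_matrices E =
     {K. transpose K = K \<and> (\<forall>i j. i \<noteq> j \<and> {i, j} \<notin> E \<longrightarrow> K $ i $ j = 0)}"

definition positive_definite :: "real^'m^'m \<Rightarrow> bool" where
  "positive_definite K \<longleftrightarrow> transpose K = K \<and> (\<forall>v. v \<noteq> 0 \<longrightarrow> v \<bullet> (K *v v) > 0)"

definition pd_graph_matrices :: "'m set set \<Rightarrow> (real^'m^'m) set" where
  "pd_graph_matrices E = {K \<in> graph_matrices E. positive_definite K}"

definition conc_act :: "real^'m^'m \<Rightarrow> real^'m^'m \<Rightarrow> real^'m^'m" where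
  "conc_act g K = transpose (matrix_inv g) ** K ** matrix_inv g"

definition model_group :: "'m set set \<Rightarrow> (real^'m^'m) set" where
  "model_group E =
     {g. invertible g \<and> conc_act g ` pd_graph_matrices E \<subseteq> pd_graph_matrices E}"

definition stable_under :: "(real^'m^'m) set \<Rightarrow> (real^'n^'m) set \<Rightarrow> bool" where
  "stable_under G U \<longleftrightarrow> (\<forall>g\<in>G. \<forall>x\<in>U. g ** x \<in> U)"

text \<open>
  \<^const>\<open>real_polynomial_function\<close> is the algebra generated by the constants and the bounded
  linear functionals.  On \<open>real^'n^'m\<close> the latter are exactly the linear forms in the matrix
  entries, so these are the functions given by real polynomials in the entries.
\<close>

definition real_algebraic_set :: "(real^'n^'m) set \<Rightarrow> bool" where
  "real_algebraic_set Z \<longleftrightarrow>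
     (\<exists>P. (\<forall>p\<in>P. real_polynomial_function p) \<and> Z = {x. \<forall>p\<in>P. p x = 0})"

text \<open>
  An equivariant map from \<open>U\<close> to the positive definite matrices of the graph; \<open>T\<close> is a total
  function whose values outside \<open>U\<close> are irrelevant whenever \<open>U\<close> is stable under the group.
\<close>

definition equivariant_estimator_on ::
    "'m set set \<Rightarrow> (real^'n^'m) set \<Rightarrow> (real^'n^'m \<Rightarrow> real^'m^'m) \<Rightarrow> bool" where
  "equivariant_estimator_on E U T \<longleftrightarrow>
     (\<forall>x\<in>U. T x \<in> pd_graph_matrices E) \<and>
     (\<forall>g\<in>model_group E. \<forall>x\<in>U. T (g ** x) = conc_act g (T x))"

text \<open>
  An estimator is only required to be defined off a proper algebraic subset of the sample space:
  no equivariant map can be defined at \<open>0\<close>, since every nonzero scalar matrix lies in the group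
  and fixes \<open>0\<close>, whereas twice the identity fixes no positive definite matrix.
\<close>

definition generic_equivariant_estimator ::
    "'m set set \<Rightarrow> (real^'n^'m) set \<Rightarrow> (real^'n^'m \<Rightarrow> real^'m^'m) \<Rightarrow> bool" where
  "generic_equivariant_estimator E Z T \<longleftrightarrow>
     real_algebraic_set Z \<and> Z \<subset> UNIV \<and> stable_under (model_group E) Z \<and>
     equivariant_estimator_on E (UNIV - Z) T"

end

theory Submission
  imports Defs
begin

text \<open>
  Write \<open>G\<close> for the group and \<open>\<down>i\<close> for the down-set of \<open>i\<close>.  Everything rests on how the stabiliser
  in \<open>G\<close> of a sample \<open>x\<close> acts on the positive definite matrices: an equivariant map at \<open>x\<close>
  must take a value fixed by that stabiliser, and conversely such fixed values, chosen on one point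
  of each orbit, extend to the orbits.

  If \<open>\<down>i\<close> has more elements than there are sample points, the rows of \<open>x\<close> indexed by \<open>\<down>i\<close> satisfy a
  linear relation \<open>c\<close>.  For all but at most one real \<open>t\<close>, the matrix \<open>1 + t e\<^sub>i c\<^sup>T\<close> lies in \<open>G\<close>, and it
  fixes \<open>x\<close>.  It moves \<open>c\<close> along the line \<open>c + \<real> e\<^sub>i\<close>, on which a positive definite form is a
  quadratic polynomial with nonzero leading coefficient; so the form is not invariant for several
  values of \<open>t\<close> at once, and no estimator exists (\<open>no_equivariant_estimator\<close>).

  If every \<open>\<down>i\<close> is small enough, a generic \<open>x\<close> has independent rows over each \<open>\<down>i\<close>; this holds for
  a Vandermonde matrix and is the nonvanishing of a product of Gram determinants.  For \<open>g \<in> G\<close>,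
  row \<open>k\<close> of \<open>g\<^sup>-\<^sup>1\<close> is supported in \<open>\<down>(\<sigma> k)\<close> for some map \<open>\<sigma>\<close> of the vertices
  (\<open>model_group_row_supports\<close>).  If \<open>g\<close> fixes \<open>x\<close>, that row expresses row \<open>k\<close> of \<open>x\<close> through
  independent rows, so \<open>\<sigma>\<close> determines \<open>g\<close>.  Hence the stabiliser of \<open>x\<close> is finite
  (\<open>finite_stabiliser\<close>), and summing its translates of the identity matrix gives a fixed positive
  definite matrix.  The exceptional set consists of the samples no translate of which is
  generic: it is stable by construction, and algebraic because an arbitrary family of
  polynomial equations may be imposed.
\<close>

section \<open>The congruence action\<close>

lemma matrix_inv_mult_right: "invertible (g :: real^'m^'m) \<Longrightarrow> g ** matrix_inv g = mat 1"
  unfolding invertible_def matrix_inv_def by (rule someI2_ex) auto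

lemma matrix_inv_mult_left: "invertible (g :: real^'m^'m) \<Longrightarrow> matrix_inv g ** g = mat 1"
  unfolding invertible_def matrix_inv_def by (rule someI2_ex) auto

lemma matrix_inv_eqI:
  fixes g h :: "real^'m^'m"
  assumes "g ** h = mat 1"
  shows "matrix_inv g = h"
proof -
  have "h ** g = mat 1" using assms by (simp add: matrix_left_right_inverse)
  then have "invertible g" using assms by (auto simp: invertible_def)
  then have "matrix_inv g ** (g ** h) = h"
    by (simp add: matrix_mul_assoc matrix_inv_mult_left)
  then show ?thesis by (simp add: assms)
qed

lemma invertible_matrix_inv: "invertible (g :: real^'m^'m) \<Longrightarrow> invertible (matrix_inv g)"
  using matrix_inv_mult_left matrix_inv_mult_right invertible_def by blast

lemma matrix_inv_matrix_inv: "invertible (g :: real^'m^'m) \<Longrightarrow> matrix_inv (matrix_inv g) = g"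
  by (simp add: matrix_inv_eqI matrix_inv_mult_left)

lemma conc_act_one: "conc_act (mat 1) K = K"
  by (simp add: conc_act_def matrix_inv_eqI)

lemma conc_act_mult:
  fixes g h :: "real^'m^'m"
  assumes "invertible g" "invertible h"
  shows "conc_act (g ** h) K = conc_act g (conc_act h K)"
proof -
  have "g ** h ** (matrix_inv h ** matrix_inv g) = g ** (h ** matrix_inv h) ** matrix_inv g"
    by (simp only: matrix_mul_assoc)
  then have "matrix_inv (g ** h) = matrix_inv h ** matrix_inv g"
    using assms by (intro matrix_inv_eqI) (simp add: matrix_inv_mult_right)
  then show ?thesis
    by (simp add: conc_act_def matrix_transpose_mul matrix_mul_assoc)
qed

lemma conc_act_quadratic_form:
  "v \<bullet> (conc_act g K *v v) = (matrix_inv g *v v) \<bullet> (K *v (matrix_inv g *v v))"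
proof -
  have "conc_act g K *v v = transpose (matrix_inv g) *v (K *v (matrix_inv g *v v))"
    by (simp add: conc_act_def matrix_vector_mul_assoc matrix_mul_assoc del: transpose_matrix_vector)
  then show ?thesis
    by (metis dot_lmul_matrix transpose_matrix_vector inner_commute)
qed

lemma conc_act_entry:
  "conc_act g K $ a $ b =
     (\<Sum>k\<in>UNIV. \<Sum>l\<in>UNIV. matrix_inv g $ k $ a * K $ k $ l * matrix_inv g $ l $ b)"
  unfolding conc_act_def matrix_matrix_mult_def transpose_def
  by (simp add: sum_distrib_right) (rule sum.swap)

lemma linear_conc_act: "linear (conc_act (g :: real^'m^'m))"
  by (rule linearI)
    (simp_all add: vec_eq_iff conc_act_entry algebra_simps sum.distrib sum_distrib_left)

lemma conc_act_symmetric: "transpose K = K \<Longrightarrow> transpose (conc_act g K) = conc_act g K"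
  by (simp add: conc_act_def matrix_transpose_mul matrix_mul_assoc)

lemma positive_definite_conc_act:
  fixes g :: "real^'m^'m"
  assumes g: "invertible g" and K: "positive_definite K"
  shows "positive_definite (conc_act g K)"
  unfolding positive_definite_def
proof (intro conjI allI impI)
  show "transpose (conc_act g K) = conc_act g K"
    using K by (simp add: conc_act_symmetric positive_definite_def)
  fix v :: "real^'m" assume "v \<noteq> 0"
  then have "matrix_inv g *v v \<noteq> 0"
    using matrix_inv_mult_right[OF g]
    by (metis matrix_vector_mul_assoc matrix_vector_mul_lid matrix_vector_mult_0_right)
  then show "v \<bullet> (conc_act g K *v v) > 0"
    using K by (simp add: conc_act_quadratic_form positive_definite_def)
qed

section \<open>The model group\<close>

definition closed_nbhd :: "'m set set \<Rightarrow> 'm \<Rightarrow> 'm set" where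
  "closed_nbhd E i = neighbours E i \<union> {i}"

lemma closed_nbhd_sym: "j \<in> closed_nbhd E i \<longleftrightarrow> i \<in> closed_nbhd E j"
  by (auto simp: closed_nbhd_def neighbours_def insert_commute)

lemma self_in_closed_nbhd [simp]: "i \<in> closed_nbhd E i"
  by (simp add: closed_nbhd_def)

lemma down_set_iff: "j \<in> down_set E i \<longleftrightarrow> closed_nbhd E i \<subseteq> closed_nbhd E j"
  by (simp add: down_set_def graph_preorder_def closed_nbhd_def)

lemma graph_matrices_iff:
  "K \<in> graph_matrices E \<longleftrightarrow> transpose K = K \<and> (\<forall>i j. j \<notin> closed_nbhd E i \<longrightarrow> K $ i $ j = 0)"
  by (auto simp: graph_matrices_def closed_nbhd_def neighbours_def)

lemma subspace_graph_matrices: "subspace (graph_matrices (E :: 'm::finite set set))"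
  by (auto simp: subspace_def graph_matrices_def transpose_def vec_eq_iff)

lemma mat_1_in_graph_matrices: "mat 1 \<in> graph_matrices E"
  by (auto simp: graph_matrices_def) (simp add: mat_def)

lemma mat_1_in_pd_graph_matrices: "mat 1 \<in> pd_graph_matrices E"
  by (simp add: pd_graph_matrices_def mat_1_in_graph_matrices positive_definite_def)

lemma pd_graph_matrices_sum:
  assumes "finite A" "A \<noteq> {}" "\<And>a. a \<in> A \<Longrightarrow> f a \<in> pd_graph_matrices (E :: 'm::finite set set)"
  shows "sum f A \<in> pd_graph_matrices E"
proof -
  have add: "K + L \<in> pd_graph_matrices E"
    if "K \<in> pd_graph_matrices E" "L \<in> pd_graph_matrices E" for K L
    using that subspace_add[OF subspace_graph_matrices]
    by (auto simp: pd_graph_matrices_def positive_definite_def graph_matrices_def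
        matrix_vector_mult_add_rdistrib inner_add_right add_pos_pos)
  show ?thesis
    using assms by (induction A rule: finite_ne_induct) (auto intro: add)
qed

text \<open>
  The positive definite matrices of the graph span the whole space of graph matrices, since a large
  multiple of the identity dominates any given matrix.
\<close>

lemma graph_matrix_shift_pd:
  assumes "K \<in> graph_matrices (E :: 'm::finite set set)"
  obtains c where "c *\<^sub>R mat 1 + K \<in> pd_graph_matrices E"
proof
  define c where "c = onorm (\<lambda>v. K *v v) + 1"
  have "v \<bullet> ((c *\<^sub>R mat 1 + K) *v v) > 0" if "v \<noteq> 0" for v :: "real^'m"
  proof -
    have "\<bar>v \<bullet> (K *v v)\<bar> \<le> norm v * norm (K *v v)"
      by (rule Cauchy_Schwarz_ineq2)
    also have "\<dots> \<le> norm v * (onorm (\<lambda>v. K *v v) * norm v)"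
      by (intro mult_left_mono onorm) (simp_all add: matrix_vector_mul_bounded_linear)
    also have "\<dots> = (c - 1) * (v \<bullet> v)"
      by (simp add: c_def dot_square_norm power2_eq_square)
    finally have "- (v \<bullet> (K *v v)) \<le> (c - 1) * (v \<bullet> v)" by linarith
    moreover have "v \<bullet> v > 0" using that by simp
    moreover have "v \<bullet> ((c *\<^sub>R mat 1 + K) *v v) = c * (v \<bullet> v) + v \<bullet> (K *v v)"
      by (simp add: matrix_vector_mult_add_rdistrib inner_add_right
          flip: scaleR_matrix_vector_assoc)
    ultimately show ?thesis by (simp only: left_diff_distrib mult_1)
  qed
  moreover have "c *\<^sub>R mat 1 + K \<in> graph_matrices E"
    by (intro subspace_add subspace_scale subspace_graph_matrices assms mat_1_in_graph_matrices)
  ultimately show "c *\<^sub>R mat 1 + K \<in> pd_graph_matrices E"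
    by (auto simp: pd_graph_matrices_def positive_definite_def graph_matrices_def)
qed

text \<open>
  Since the cone spans, preserving it is a linear condition.  In this form the group can be
  tested on the elementary matrices of edges and vertices, and closure under inverses becomes a
  dimension count.
\<close>

lemma model_group_iff:
  "g \<in> model_group (E :: 'm::finite set set) \<longleftrightarrow>
     invertible g \<and> conc_act g ` graph_matrices E \<subseteq> graph_matrices E"
proof (intro iffI conjI subsetI)
  assume g: "g \<in> model_group E"
  then show "invertible g" by (simp add: model_group_def)
  fix L assume "L \<in> conc_act g ` graph_matrices E"
  then obtain K where K: "K \<in> graph_matrices E" and L: "L = conc_act g K" by blast
  have pd: "conc_act g A \<in> graph_matrices E" if "A \<in> pd_graph_matrices E" for A
    using g that by (auto simp: model_group_def pd_graph_matrices_def)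
  obtain c where "c *\<^sub>R mat 1 + K \<in> pd_graph_matrices E"
    using graph_matrix_shift_pd[OF K] .
  moreover have "L = conc_act g (c *\<^sub>R mat 1 + K) - c *\<^sub>R conc_act g (mat 1)"
    by (simp add: L linear_add[OF linear_conc_act] linear_scale[OF linear_conc_act])
  ultimately show "L \<in> graph_matrices E"
    using pd mat_1_in_pd_graph_matrices subspace_graph_matrices
    by (metis subspace_diff subspace_scale)
qed (auto simp: model_group_def pd_graph_matrices_def positive_definite_conc_act)

lemma model_group_one: "mat 1 \<in> model_group (E :: 'm::finite set set)"
  by (auto simp: model_group_def conc_act_one invertible_def)

lemma model_group_mult:
  assumes "g \<in> model_group (E :: 'm::finite set set)" "h \<in> model_group E"
  shows "g ** h \<in> model_group E"
  using assms by (auto simp: model_group_def conc_act_mult invertible_mult)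

text \<open>
  An injective linear map of a finite-dimensional space into itself is onto, so the
  inverse preserves the graph matrices as well.
\<close>

lemma model_group_inv:
  assumes g: "g \<in> model_group (E :: 'm::finite set set)"
  shows "matrix_inv g \<in> model_group E"
proof -
  let ?S = "graph_matrices E"
  have inv: "invertible g" and sub: "conc_act g ` ?S \<subseteq> ?S"
    using g by (auto simp: model_group_iff)
  have cancel: "conc_act (matrix_inv g) (conc_act g K) = K" for K
    using inv by (simp add: conc_act_one matrix_inv_mult_left invertible_matrix_inv
        flip: conc_act_mult)
  then have "inj (conc_act g)" by (metis injI)
  then have "dim (conc_act g ` ?S) = dim ?S"
    by (intro dim_image_eq linear_conc_act) (auto simp: inj_on_def)
  then have "conc_act g ` ?S = ?S"
    by (intro subspace_dim_equal[OF linear_subspace_image[OF linear_conc_act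
            subspace_graph_matrices] subspace_graph_matrices sub]) (simp only: order_refl)
  then have "conc_act (matrix_inv g) ` ?S = (\<lambda>K. conc_act (matrix_inv g) (conc_act g K)) ` ?S"
    by (metis image_image)
  then have "conc_act (matrix_inv g) ` ?S \<subseteq> ?S"
    by (simp add: cancel)
  then show ?thesis
    using inv by (simp add: model_group_iff invertible_matrix_inv)
qed

text \<open>
  For adjacent or equal \<open>p\<close> and \<open>q\<close>, the matrix \<open>e\<^sub>p e\<^sub>q\<^sup>T + e\<^sub>q e\<^sub>p\<^sup>T\<close> is a graph matrix.  Its image
  under \<open>g\<close> must vanish at every pair \<open>(a, b)\<close> of distinct non-adjacent vertices, which is a bilinear relation between
  rows \<open>p\<close> and \<open>q\<close> of the inverse of \<open>g\<close>.
\<close>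

lemma model_group_row_pair_supports:
  assumes g: "g \<in> model_group (E :: 'm::finite set set)"
    and kl: "l \<in> closed_nbhd E k"
    and a: "matrix_inv g $ k $ a \<noteq> 0" and b: "matrix_inv g $ l $ b \<noteq> 0"
  shows "b \<in> closed_nbhd E a"
proof (rule ccontr)
  assume ab: "b \<notin> closed_nbhd E a"
  let ?h = "matrix_inv g"
  have *: "?h $ p $ a * ?h $ q $ b + ?h $ q $ a * ?h $ p $ b = 0"
    if pq: "q \<in> closed_nbhd E p" for p q
  proof -
    define K :: "real^'m^'m" where
      "K = (\<chi> i j. (if i = p then 1 else 0) * (if j = q then 1 else 0)
                 + (if i = q then 1 else 0) * (if j = p then 1 else 0))"
    have "K \<in> graph_matrices E"
      using pq closed_nbhd_sym[of q E p]
      by (auto simp: graph_matrices_iff K_def transpose_def vec_eq_iff)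
    then have "conc_act g K \<in> graph_matrices E"
      using g by (auto simp: model_group_iff)
    then have "conc_act g K $ a $ b = 0"
      using ab by (simp add: graph_matrices_iff)
    moreover have "conc_act g K $ a $ b = ?h $ p $ a * ?h $ q $ b + ?h $ q $ a * ?h $ p $ b"
      by (simp add: conc_act_entry K_def algebra_simps sum.distrib
          if_distrib[of "\<lambda>x. x * _"] if_distrib[of "\<lambda>x. _ * x"] cong: if_cong)
    ultimately show ?thesis by simp
  qed
  \<comment> \<open>The relation for \<open>p = q = k\<close> kills one of the two products in the relation for \<open>(k, l)\<close>.\<close>
  have "?h $ k $ b = 0" using *[of k k] a by simp
  then show False using *[OF kl] a b by simp
qed

text \<open>
  A nonzero term of the determinant of the inverse gives a permutation \<open>\<sigma>\<close> with nonzero entries at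
  all \<open>(i, \<sigma> i)\<close>.  By the previous lemma it preserves adjacency, and because the graph is
  finite it maps \<open>N[k]\<close> onto \<open>N[\<sigma> k]\<close>.  A further nonzero entry \<open>(k, a)\<close> forces \<open>a\<close> to be
  adjacent or equal to everything in \<open>\<sigma> ` N[k] = N[\<sigma> k]\<close>, which is the relation \<open>a \<preceq> \<sigma> k\<close>.
\<close>

lemma model_group_row_supports:
  assumes g: "g \<in> model_group (E :: 'm::finite set set)"
  obtains \<sigma> where "\<And>k a. matrix_inv g $ k $ a \<noteq> 0 \<Longrightarrow> a \<in> down_set E (\<sigma> k)"
proof -
  let ?h = "matrix_inv g"
  have "det ?h \<noteq> 0"
    using g by (simp add: model_group_def invertible_matrix_inv flip: invertible_det_nz)
  then obtain \<sigma> where \<sigma>: "\<sigma> permutes UNIV" and "(\<Prod>i\<in>UNIV. ?h $ i $ \<sigma> i) \<noteq> 0"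
    unfolding det_def by (metis (mono_tags, lifting) mem_Collect_eq mult_zero_right sum.neutral)
  then have diag: "?h $ i $ \<sigma> i \<noteq> 0" for i by simp
  define A where "A = {(i, j). j \<in> closed_nbhd E i}"
  have into: "map_prod \<sigma> \<sigma> ` A \<subseteq> A"
    using model_group_row_pair_supports[OF g _ diag diag] by (auto simp: A_def)
  have "inj_on (map_prod \<sigma> \<sigma>) A"
    using permutes_inj[OF \<sigma>] by (auto simp: inj_on_def inj_def)
  then have onto: "map_prod \<sigma> \<sigma> ` A = A"
    using into by (intro endo_inj_surj) auto
  have "a \<in> down_set E (\<sigma> k)" if ka: "?h $ k $ a \<noteq> 0" for k a
    unfolding down_set_iff
  proof
    fix b assume "b \<in> closed_nbhd E (\<sigma> k)"
    then have "(\<sigma> k, b) \<in> map_prod \<sigma> \<sigma> ` A" by (simp add: onto) (simp add: A_def)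
    then obtain l where "l \<in> closed_nbhd E k" "b = \<sigma> l"
      using permutes_inj[OF \<sigma>] by (auto simp: A_def inj_def)
    then show "b \<in> closed_nbhd E a"
      using model_group_row_pair_supports[OF g _ ka diag] by blast
  qed
  then show thesis using that by blast
qed


text \<open>
  In the \<open>(a, b)\<close> entry of the transformed matrix, a nonzero term \<open>h\<^sub>k\<^sub>a K\<^sub>k\<^sub>l h\<^sub>l\<^sub>b\<close> has
  \<open>l \<in> N[k] \<subseteq> N[a]\<close>, hence \<open>a \<in> N[l] \<subseteq> N[b]\<close>.
\<close>

lemma model_group_if_inverse_pattern:
  assumes g: "invertible g"
    and pattern: "\<And>k a. matrix_inv g $ k $ a \<noteq> 0 \<Longrightarrow> a \<in> down_set E k"
  shows "g \<in> model_group (E :: 'm::finite set set)"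
  unfolding model_group_iff
proof (intro conjI image_subsetI g)
  fix K assume K: "K \<in> graph_matrices E"
  let ?h = "matrix_inv g"
  have "conc_act g K $ a $ b = 0" if ab: "b \<notin> closed_nbhd E a" for a b
    unfolding conc_act_entry
  proof (intro sum.neutral ballI, rule ccontr)
    fix k l assume "?h $ k $ a * K $ k $ l * ?h $ l $ b \<noteq> 0"
    then have "a \<in> down_set E k" "l \<in> closed_nbhd E k" "b \<in> down_set E l"
      using pattern K by (auto simp: graph_matrices_iff)
    then have "b \<in> closed_nbhd E a"
      by (meson closed_nbhd_sym down_set_iff subsetD)
    with ab show False ..
  qed
  then show "conc_act g K \<in> graph_matrices E"
    using K by (simp add: graph_matrices_iff conc_act_symmetric)
qed

section \<open>Samples with dependent rows\<close>

text \<open>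
  The matrix \<open>1 + e\<^sub>i c\<^sup>T\<close>, which adds the combination \<open>c\<close> of the rows to row \<open>i\<close>.
\<close>

definition shear :: "'m \<Rightarrow> real^'m \<Rightarrow> real^'m^'m" where
  "shear i c = mat 1 + (\<chi> a b. if a = i then c $ b else 0)"

lemma shear_mult_vec: "shear i c *v v = v + (c \<bullet> v) *\<^sub>R axis i 1"
  by (simp add: shear_def matrix_vector_mult_add_rdistrib)
    (simp add: vec_eq_iff matrix_vector_mult_def axis_def inner_vec_def)

lemma shear_mult_mat_eq_self:
  assumes "c v* x = 0"
  shows "shear i c ** x = x"
proof -
  have "(shear i c ** x) $ a $ k = x $ a $ k + (if a = i then (c v* x) $ k else 0)" for a k
    by (cases "a = i")
      (simp_all add: matrix_matrix_mult_def vector_matrix_mult_def shear_def mat_def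
        algebra_simps sum.distrib if_distrib[of "\<lambda>x. _ * x"] cong: if_cong)
  then show ?thesis by (simp add: assms vec_eq_iff)
qed

lemma shear_mult_shear: "shear i c ** shear i d = shear i (c + d + c $ i *\<^sub>R d)"
proof -
  have "(shear i c ** shear i d) *v v = shear i (c + d + c $ i *\<^sub>R d) *v v" for v
    by (simp add: shear_mult_vec inner_add_left inner_add_right inner_axis algebra_simps
        flip: matrix_vector_mul_assoc)
  then show ?thesis by (simp add: matrix_eq)
qed

lemma shear_zero: "shear i 0 = mat 1"
  by (simp add: shear_def vec_eq_iff)

lemma shear_mult_inverse:
  assumes "1 + c $ i \<noteq> 0"
  shows "shear i c ** shear i (- (1 / (1 + c $ i)) *\<^sub>R c) = mat 1"
proof -
  define s where "s = 1 / (1 + c $ i)"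
  have s: "s + s * c $ i = 1"
    using assms by (simp add: s_def field_simps)
  have "c + - s *\<^sub>R c + c $ i *\<^sub>R (- s *\<^sub>R c) = (1 - (s + s * c $ i)) *\<^sub>R c"
    by (simp add: algebra_simps)
  then show ?thesis
    by (simp add: s shear_mult_shear shear_zero flip: s_def)
qed

text \<open>
  The inverse is again a shear along a multiple of \<open>c\<close>, so its row \<open>i\<close> is supported in the down-set of \<open>i\<close>.
\<close>

lemma shear_in_model_group:
  assumes i: "1 + c $ i \<noteq> 0" and supp: "\<And>j. c $ j \<noteq> 0 \<Longrightarrow> j \<in> down_set E i"
  shows "shear i c \<in> model_group (E :: 'm::finite set set)"
proof (rule model_group_if_inverse_pattern)
  have right: "shear i c ** shear i (- (1 / (1 + c $ i)) *\<^sub>R c) = mat 1"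
    using i by (rule shear_mult_inverse)
  then show "invertible (shear i c)"
    unfolding invertible_def using matrix_left_right_inverse by blast
  fix k a assume "matrix_inv (shear i c) $ k $ a \<noteq> 0"
  then show "a \<in> down_set E k"
    unfolding matrix_inv_eqI[OF right]
    using supp by (auto simp: shear_def mat_def down_set_iff split: if_splits)
qed

text \<open>
  The matrices \<open>1 + t e\<^sub>i c\<^sup>T\<close> fix \<open>x\<close> because \<open>c\<close> is a relation between its rows.  If they all fixed
  \<open>K\<close>, the form of \<open>K\<close> would take the same value at \<open>c\<close> and at \<open>c + t (c \<bullet> c) e\<^sub>i\<close>; its values for
  \<open>t = 0, 1, 2\<close> show that the coefficient of \<open>t\<^sup>2\<close> is zero.
\<close>

lemma no_fixed_pd_matrix_if_dependent:
  fixes x :: "real^'n^'m::finite"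
  assumes "c \<noteq> 0" "\<And>j. c $ j \<noteq> 0 \<Longrightarrow> j \<in> down_set E i" "c v* x = 0"
    and K: "positive_definite K"
  shows "\<exists>g\<in>model_group E. g ** x = x \<and> conc_act g K \<noteq> K"
proof (rule ccontr)
  assume "\<not> ?thesis"
  then have fixed: "conc_act g K = K" if "g \<in> model_group E" "g ** x = x" for g
    using that by blast
  \<comment> \<open>The sign makes \<open>1 + t d\<^sub>i\<close> nonzero for every positive \<open>t\<close>, as invertibility of the shear requires.\<close>
  define d where "d = (if c $ i \<ge> 0 then 1 else - 1) *\<^sub>R c"
  define e :: "real^'m" where "e = axis i 1"
  define q where "q v = v \<bullet> (K *v v)" for v
  define B where "B = d \<bullet> (K *v e) + e \<bullet> (K *v d)"
  define u where "u = d \<bullet> d"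
  have expand: "q (d + s *\<^sub>R e) = q d + s * B + s\<^sup>2 * q e" for s
    by (simp add: q_def B_def matrix_vector_right_distrib matrix_vector_mult_scaleR
        inner_add_left inner_add_right algebra_simps power2_eq_square)
  have invariant: "q (d + (t * u) *\<^sub>R e) = q d" if "t > 0" for t
  proof -
    let ?g = "shear i (t *\<^sub>R d)"
    have "0 \<le> d $ i" by (simp add: d_def)
    then have "0 \<le> t * d $ i" using that by simp
    then have g: "?g \<in> model_group E"
      using assms(2) by (intro shear_in_model_group) (auto simp: d_def split: if_splits)
    have "(t *\<^sub>R d) v* x = 0"
      using assms(3) by (auto simp: d_def vec_eq_iff vector_matrix_mult_def sum_negf mult.assoc
          simp flip: sum_distrib_left)
    then have "conc_act ?g K = K"
      using g by (intro fixed shear_mult_mat_eq_self)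
    then have "q (?g *v d) = (matrix_inv ?g *v (?g *v d)) \<bullet> (K *v (matrix_inv ?g *v (?g *v d)))"
      unfolding q_def by (metis conc_act_quadratic_form)
    also have "matrix_inv ?g *v (?g *v d) = d"
      using g by (simp add: matrix_vector_mul_assoc matrix_inv_mult_left model_group_def)
    finally show ?thesis
      by (simp add: shear_mult_vec q_def u_def e_def)
  qed
  have "u * B + u\<^sup>2 * q e = 0" "2 * u * B + 4 * u\<^sup>2 * q e = 0"
    using invariant[of 1] invariant[of 2] by (simp_all add: expand power_mult_distrib)
  then have "u\<^sup>2 * q e = 0" by linarith
  moreover have "u \<noteq> 0" using assms(1) by (simp add: u_def d_def)
  moreover have "q e > 0"
    using K by (simp add: q_def e_def positive_definite_def axis_eq_0_iff)
  ultimately show False by simp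
qed

lemma exists_vanishing_combination:
  fixes x :: "real^'n^'m::finite"
  assumes "card D > CARD('n)"
  obtains c where "c \<noteq> 0" "\<And>j. c $ j \<noteq> 0 \<Longrightarrow> j \<in> D" "c v* x = 0"
proof -
  define S :: "(real^'m) set" where "S = {c. \<forall>j. j \<notin> D \<longrightarrow> c $ j = 0}"
  have S: "subspace S" by (auto simp: S_def subspace_def)
  have dim: "dim S = card D"
    using dim_substandard_cart[of D, where 'a = real] by (simp add: S_def dim_vec_eq)
  have lin: "linear (\<lambda>c. c v* x)"
    by (rule linearI) (simp_all add: vector_matrix_mult_def vec_eq_iff algebra_simps sum.distrib
        sum_distrib_left)
  have "dim ((\<lambda>c. c v* x) ` S) \<le> CARD('n)"
    using dim_subset_UNIV[of "(\<lambda>c. c v* x) ` S"] by simp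
  then have "\<not> inj_on (\<lambda>c. c v* x) (span S)"
    using dim_image_eq[OF lin, of S] assms dim by auto
  then have "\<not> inj_on (\<lambda>c. c v* x) S"
    using S by (metis span_eq_iff)
  then obtain c where "c \<in> S" "c v* x = 0" "c \<noteq> 0"
    using linear_injective_on_subspace_0[OF lin S] by blast
  then show thesis
    using that by (auto simp: S_def)
qed

lemma no_equivariant_estimator:
  fixes U :: "(real^'n^'m::finite) set"
  assumes "card (down_set E i) > CARD('n)" "U \<noteq> {}"
  shows "\<not> equivariant_estimator_on E U T"
proof
  assume T: "equivariant_estimator_on E U T"
  from assms(2) obtain x where x: "x \<in> U" by blast
  obtain c where c: "c \<noteq> 0" "\<And>j. c $ j \<noteq> 0 \<Longrightarrow> j \<in> down_set E i" "c v* x = 0"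
    by (rule exists_vanishing_combination[OF assms(1), where x = x]) blast
  have "positive_definite (T x)"
    using T x by (auto simp: equivariant_estimator_on_def pd_graph_matrices_def)
  then obtain g where "g \<in> model_group E" "g ** x = x" "conc_act g (T x) \<noteq> T x"
    using no_fixed_pd_matrix_if_dependent[OF c] by blast
  then show False
    using T x by (metis equivariant_estimator_on_def)
qed

section \<open>Independence of rows as a polynomial condition\<close>

text \<open>
  The Gram matrix of the rows in \<open>D\<close>, completed by an identity block, so that subsets of every size
  give square matrices of one type.
\<close>

definition gram :: "'m set \<Rightarrow> real^'n^'m \<Rightarrow> real^'m^'m" where
  "gram D x = (\<chi> a b. if a \<in> D \<and> b \<in> D then x $ a \<bullet> x $ b else if a = b then 1 else 0)"

text \<open>
  Independence of the family of rows indexed by \<open>D\<close>, where repeated rows count as dependent.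
\<close>

definition independent_rows :: "'m set \<Rightarrow> real^'n^'m \<Rightarrow> bool" where
  "independent_rows D x \<longleftrightarrow> (\<forall>c. (\<forall>j. c $ j \<noteq> 0 \<longrightarrow> j \<in> D) \<and> c v* x = 0 \<longrightarrow> c = 0)"

lemma inner_vec_mult_mat:
  fixes y :: "real^'n" and x :: "real^'n^'m"
  shows "y \<bullet> (c v* x) = (\<Sum>b\<in>UNIV. (y \<bullet> x $ b) * c $ b)"
  unfolding inner_vec_def vector_matrix_mult_def
  by (simp add: sum_distrib_left sum_distrib_right mult_ac)
    (rule sum.swap)

lemma gram_mult_vec:
  assumes "\<And>j. c $ j \<noteq> 0 \<Longrightarrow> j \<in> D"
  shows "gram D x *v c = (\<chi> a. if a \<in> D then x $ a \<bullet> (c v* x) else 0)"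
proof -
  have zero: "c $ j = 0" if "j \<notin> D" for j using assms that by blast
  have "(\<Sum>b\<in>UNIV. gram D x $ a $ b * c $ b) = (if a \<in> D then x $ a \<bullet> (c v* x) else 0)" for a
    using zero by (auto simp: gram_def inner_vec_mult_mat intro!: sum.cong sum.neutral)
  then show ?thesis by (simp add: matrix_vector_mult_def vec_eq_iff)
qed

lemma gram_mult_vec_outside: "a \<notin> D \<Longrightarrow> (gram D x *v c) $ a = c $ a"
  by (simp add: gram_def matrix_vector_mult_def if_distrib[of "\<lambda>x. x * _"] cong: if_cong)

text \<open>
  A vector \<open>c\<close> in the kernel is supported in \<open>D\<close>, and pairing the kernel equation with \<open>c\<close> gives the
  squared norm of the combination \<open>c\<close> of the rows; so the kernel is the space of relations.
\<close>

lemma det_gram_nonzero_iff: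
  fixes x :: "real^'n^'m::finite"
  shows "det (gram D x) \<noteq> 0 \<longleftrightarrow> independent_rows D x"
proof -
  have "c = 0" if "independent_rows D x" "gram D x *v c = 0" for c
  proof -
    have supp: "j \<in> D" if "c $ j \<noteq> 0" for j
      using gram_mult_vec_outside[of j D, where x = x and c = c] \<open>gram D x *v c = 0\<close> that by auto
    have "x $ a \<bullet> (c v* x) = 0" if "a \<in> D" for a
      using gram_mult_vec[OF supp, where x = x] \<open>gram D x *v c = 0\<close> that
      by (simp add: vec_eq_iff) (metis inner_commute)
    then have "(\<Sum>b\<in>UNIV. ((c v* x) \<bullet> x $ b) * c $ b) = 0"
      using supp by (intro sum.neutral) (auto simp: inner_commute)
    then have "(c v* x) \<bullet> (c v* x) = 0"
      by (simp only: inner_vec_mult_mat[of "c v* x"])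
    then show ?thesis using that supp by (auto simp: independent_rows_def)
  qed
  moreover have "independent_rows D x" if "\<And>c. gram D x *v c = 0 \<Longrightarrow> c = 0"
    unfolding independent_rows_def
  proof (intro allI impI)
    fix c :: "real^'m" assume c: "(\<forall>j. c $ j \<noteq> 0 \<longrightarrow> j \<in> D) \<and> c v* x = 0"
    then have supp: "\<And>j. c $ j \<noteq> 0 \<Longrightarrow> j \<in> D" and zero: "c v* x = 0" by auto
    have "gram D x *v c = 0"
      by (simp add: gram_mult_vec[OF supp] zero cong: if_cong) (simp add: zero_vec_def)
    then show "c = 0" by (rule that)
  qed
  ultimately show ?thesis
    by (auto simp: invertible_left_inverse matrix_left_invertible_ker simp flip: invertible_det_nz)
qed

lemma real_polynomial_function_det_gram:
  "real_polynomial_function (\<lambda>x :: real^'n^'m::finite. det (gram D (g ** x)))"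
proof -
  have lin: "real_polynomial_function (\<lambda>x :: real^'n^'m. (g ** x) $ a $ k)" for a k
    by (intro real_polynomial_function.intros(1) linear_conv_bounded_linear[THEN iffD1] linearI)
      (simp_all add: matrix_matrix_mult_def algebra_simps sum.distrib sum_distrib_left)
  have "real_polynomial_function (\<lambda>x :: real^'n^'m. gram D (g ** x) $ a $ b)" for a b
    using lin by (cases "a \<in> D \<and> b \<in> D"; cases "a = b") (auto simp: gram_def inner_vec_def
        intro!: real_polynomial_function_sum real_polynomial_function.intros(3,4))
  then show ?thesis
    unfolding det_def
    by (intro real_polynomial_function_sum real_polynomial_function_prod
        real_polynomial_function.intros(2,4)) auto
qed

text \<open>
  The nonsingularity of the Vandermonde matrix by Lagrange interpolation: the moments of \<open>c\<close> annihilate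
  every polynomial of degree below \<open>n\<close>, in particular the one vanishing on \<open>D\<close> except at \<open>a\<close>.
\<close>

lemma vanishing_moments:
  fixes c t :: "'m::finite \<Rightarrow> real"
  assumes t: "inj_on t D" and supp: "\<And>j. c j \<noteq> 0 \<Longrightarrow> j \<in> D" and D: "card D \<le> n"
    and moments: "\<And>p. p < n \<Longrightarrow> (\<Sum>j\<in>UNIV. c j * t j ^ p) = 0"
  shows "c a = 0"
proof (rule ccontr)
  assume ca: "c a \<noteq> 0"
  then have aD: "a \<in> D" by (rule supp)
  define q where "q = (\<Prod>b\<in>D - {a}. [:- t b, 1:])"
  have "degree q = card (D - {a})"
    by (simp add: q_def degree_prod_eq_sum_degree)
  then have deg: "degree q < n"
    using D aD by (metis card_Diff1_less finite order_less_le_trans)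
  have "(\<Sum>j\<in>UNIV. c j * poly q (t j)) = (\<Sum>p\<le>degree q. coeff q p * (\<Sum>j\<in>UNIV. c j * t j ^ p))"
    unfolding poly_altdef sum_distrib_left by (subst sum.swap) (simp add: mult_ac)
  also have "\<dots> = 0" using moments deg by simp
  finally have "(\<Sum>j\<in>UNIV. c j * poly q (t j)) = 0" .
  moreover have "(\<Sum>j\<in>UNIV. c j * poly q (t j)) = (\<Sum>j\<in>{a}. c j * poly q (t j))"
    using supp by (intro sum.mono_neutral_right) (auto simp: q_def poly_prod)
  moreover have "poly q (t a) \<noteq> 0"
    using t aD by (auto simp: q_def poly_prod inj_on_def)
  ultimately show False using ca by simp
qed

text \<open>
  A Vandermonde matrix with distinct nodes works for all small index sets simultaneously.
\<close>

lemma exists_independent_rows: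
  obtains x :: "real^'n^'m::finite" where "\<And>D. card D \<le> CARD('n) \<Longrightarrow> independent_rows D x"
proof -
  obtain e :: "'m \<Rightarrow> nat" where e: "inj e"
    using finite_imp_inj_to_nat_seg[of "UNIV :: 'm set"] by auto
  obtain f :: "'n \<Rightarrow> nat" where f: "bij_betw f UNIV {0..<CARD('n)}"
    using ex_bij_betw_finite_nat[of "UNIV :: 'n set"] by auto
  define x :: "real^'n^'m" where "x = (\<chi> j k. real (e j) ^ f k)"
  have "independent_rows D x" if D: "card D \<le> CARD('n)" for D
    unfolding independent_rows_def
  proof (intro allI impI)
    fix c :: "real^'m"
    assume c: "(\<forall>j. c $ j \<noteq> 0 \<longrightarrow> j \<in> D) \<and> c v* x = 0"
    have "(\<Sum>j\<in>UNIV. c $ j * real (e j) ^ p) = 0" if "p < CARD('n)" for p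
    proof -
      have "p \<in> range f" using f that by (simp add: bij_betw_def)
      then obtain k where "p = f k" by blast
      then show ?thesis
        using c by (auto simp: x_def vector_matrix_mult_def vec_eq_iff mult.commute)
    qed
    then have "c $ a = 0" for a
      using e c D by (intro vanishing_moments[of "\<lambda>j. real (e j)" D "\<lambda>j. c $ j"])
        (auto simp: inj_on_def)
    then show "c = 0" by (simp add: vec_eq_iff)
  qed
  then show thesis using that by blast
qed

section \<open>Estimators from generic samples\<close>

definition general_position :: "'m set set \<Rightarrow> (real^'n^'m) set" where
  "general_position E = {x. \<forall>i. independent_rows (down_set E i) x}"

lemma model_group_cancel:
  assumes "g \<in> model_group E"
  shows "matrix_inv g ** (g ** x) = x"
proof -
  have "matrix_inv g ** g = mat 1"
    using assms by (simp add: matrix_inv_mult_left model_group_def)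
  then show ?thesis by (simp add: matrix_mul_assoc)
qed

text \<open>
  An element \<open>g\<close> of the stabiliser is determined by the vertex map \<open>\<sigma>\<close> that bounds the row
  supports of its inverse: row \<open>k\<close> of the inverse gives the coefficients of row \<open>k\<close> of \<open>x\<close> in terms of
  the independent rows over the down-set of \<open>\<sigma> k\<close>.  There are only finitely many vertex maps.
\<close>

lemma finite_stabiliser:
  fixes x :: "real^'n^'m::finite"
  assumes x: "x \<in> general_position E"
  shows "finite {g \<in> model_group E. g ** x = x}" (is "finite ?S")
proof -
  have "\<forall>g\<in>model_group E. \<exists>\<sigma>. \<forall>k a. matrix_inv g $ k $ a \<noteq> 0 \<longrightarrow> a \<in> down_set E (\<sigma> k)"
    using model_group_row_supports by metis
  then obtain \<sigma> where \<sigma>: "\<And>g k a. g \<in> model_group E \<Longrightarrow> matrix_inv g $ k $ a \<noteq> 0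
      \<Longrightarrow> a \<in> down_set E (\<sigma> g k)"
    by metis
  have row: "matrix_inv g $ k v* x = x $ k" if "g \<in> ?S" for g k
  proof -
    have "matrix_inv g ** x = matrix_inv g ** (g ** x)" using that by simp
    also have "\<dots> = x"
      using that by (intro model_group_cancel[of g E]) simp
    finally have "matrix_inv g ** x = x" .
    moreover have "(matrix_inv g ** x) $ k = matrix_inv g $ k v* x"
      by (simp add: vec_eq_iff matrix_matrix_mult_def vector_matrix_mult_def mult.commute)
    ultimately show ?thesis by simp
  qed
  have "inj_on \<sigma> ?S"
  proof (rule inj_onI)
    fix g h assume g: "g \<in> ?S" and h: "h \<in> ?S" and eq: "\<sigma> g = \<sigma> h"
    have "matrix_inv g $ k - matrix_inv h $ k = 0" for k
    proof -
      let ?d = "matrix_inv g $ k - matrix_inv h $ k"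
      have "?d v* x = matrix_inv g $ k v* x - matrix_inv h $ k v* x"
        by (simp add: vec_eq_iff vector_matrix_mult_def algebra_simps sum_subtractf)
      then have "?d v* x = 0" using row g h by simp
      moreover have "j \<in> down_set E (\<sigma> g k)" if "?d $ j \<noteq> 0" for j
        using that \<sigma>[of g k j] \<sigma>[of h k j] g h eq by force
      ultimately show ?thesis
        using x unfolding general_position_def independent_rows_def by blast
    qed
    then have "matrix_inv g = matrix_inv h" by (simp add: vec_eq_iff)
    then show "g = h"
      using g h by (metis (no_types, lifting) matrix_inv_matrix_inv mem_Collect_eq model_group_def)
  qed
  then show ?thesis by (rule inj_on_finite[where B = UNIV]) auto
qed

text \<open>
  Positive definite graph matrices form a convex cone, so the sum over a finite stabiliser stays in
  it, and translation by a stabiliser element only permutes the summands.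
\<close>

lemma exists_fixed_pd_matrix:
  fixes x :: "real^'n^'m::finite"
  assumes fin: "finite {g \<in> model_group E. g ** x = x}" (is "finite ?S")
  shows "\<exists>K\<in>pd_graph_matrices E. \<forall>g\<in>model_group E. g ** x = x \<longrightarrow> conc_act g K = K"
proof -
  define K :: "real^'m^'m" where "K = (\<Sum>h\<in>?S. conc_act h (mat 1))"
  have "mat 1 \<in> ?S" by (simp add: model_group_one)
  then have "?S \<noteq> {}" by blast
  moreover have "conc_act h (mat 1) \<in> pd_graph_matrices E" if "h \<in> ?S" for h
    using that mat_1_in_pd_graph_matrices[of E] by (auto simp: model_group_def)
  ultimately have "K \<in> pd_graph_matrices E"
    unfolding K_def using fin by (intro pd_graph_matrices_sum)
  moreover have "conc_act g K = K" if g: "g \<in> model_group E" "g ** x = x" for g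
  proof -
    have inj: "inj_on (\<lambda>h. g ** h) ?S"
      by (rule inj_on_inverseI[where g = "\<lambda>h. matrix_inv g ** h"]) (rule model_group_cancel[OF g(1)])
    have "(\<lambda>h. g ** h) ` ?S \<subseteq> ?S"
      using g by (auto simp: model_group_mult simp flip: matrix_mul_assoc)
    then have onto: "(\<lambda>h. g ** h) ` ?S = ?S"
      using fin inj by (intro endo_inj_surj)
    have "conc_act g K = (\<Sum>h\<in>?S. conc_act (g ** h) (mat 1))"
      unfolding K_def linear_sum[OF linear_conc_act]
      using g by (intro sum.cong) (auto simp: conc_act_mult model_group_def)
    also have "\<dots> = (\<Sum>h\<in>(\<lambda>h. g ** h) ` ?S. conc_act h (mat 1))"
      using inj by (simp add: sum.reindex)
    also have "\<dots> = K" by (simp only: onto K_def)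
    finally show ?thesis .
  qed
  ultimately show ?thesis by blast
qed

text \<open>
  On each orbit meeting \<open>Y\<close> a representative in \<open>Y\<close> is chosen, and its value is transported by any group
  element carrying it to the given point.  Two such elements differ by an element of the stabiliser of
  the representative, which fixes the value.
\<close>

lemma equivariant_extension:
  fixes Y :: "(real^'n^'m::finite) set"
  assumes "\<And>y. y \<in> Y \<Longrightarrow> \<exists>K\<in>pd_graph_matrices E. \<forall>g\<in>model_group E. g ** y = y \<longrightarrow> conc_act g K = K"
  shows "\<exists>T. equivariant_estimator_on E {x. \<exists>g\<in>model_group E. g ** x \<in> Y} T"
proof -
  let ?G = "model_group E"
  let ?U = "{x. \<exists>g\<in>?G. g ** x \<in> Y}"
  have inv: "matrix_inv g ** (g ** x) = x" if "g \<in> ?G" for g and x :: "real^'n^'m"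
    using that by (rule model_group_cancel)
  obtain \<kappa> where \<kappa>: "\<And>y. y \<in> Y \<Longrightarrow> \<kappa> y \<in> pd_graph_matrices E"
    "\<And>y g. y \<in> Y \<Longrightarrow> g \<in> ?G \<Longrightarrow> g ** y = y \<Longrightarrow> conc_act g (\<kappa> y) = \<kappa> y"
    using assms by metis
  define orbit where "orbit x = (\<lambda>g. g ** x) ` ?G" for x :: "real^'n^'m"
  \<comment> \<open>The choice depends on \<open>x\<close> only through its orbit, so \<open>x\<close> and \<open>g ** x\<close> get the same representative.\<close>
  define rep where "rep x = (SOME y. y \<in> orbit x \<inter> Y)" for x
  define frame where "frame x = (SOME g. g \<in> ?G \<and> g ** rep x = x)" for x
  define T where "T x = conc_act (frame x) (\<kappa> (rep x))" for x
  have rep: "rep x \<in> orbit x \<inter> Y" if "x \<in> ?U" for x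
    unfolding rep_def using that by (intro someI_ex[of "\<lambda>y. y \<in> orbit x \<inter> Y"]) (auto simp: orbit_def)
  have frame: "frame x \<in> ?G \<and> frame x ** rep x = x" if x: "x \<in> ?U" for x
    unfolding frame_def
  proof (rule someI_ex)
    obtain g where "g \<in> ?G" "rep x = g ** x"
      using rep[OF x] by (auto simp: orbit_def)
    then show "\<exists>g. g \<in> ?G \<and> g ** rep x = x"
      using inv model_group_inv by metis
  qed
  have orbit: "orbit (g ** x) = orbit x" if g: "g \<in> ?G" for g x
  proof -
    have "orbit (g ** x) \<subseteq> orbit x" if "g \<in> ?G" for g x
      using that model_group_mult by (auto simp: orbit_def matrix_mul_assoc)
    from this[OF g] this[OF model_group_inv[OF g], of "g ** x"] show ?thesis
      by (auto simp: inv[OF g])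
  qed
  have U: "g ** x \<in> ?U" if g: "g \<in> ?G" and x: "x \<in> ?U" for g x
  proof -
    have "?U = {x. orbit x \<inter> Y \<noteq> {}}" by (auto simp: orbit_def)
    then show ?thesis using x orbit[OF g, of x] by simp
  qed
  have "T x \<in> pd_graph_matrices E" if x: "x \<in> ?U" for x
    using frame[OF x] \<kappa>(1)[of "rep x"] rep[OF x] by (auto simp: T_def model_group_def)
  moreover have "T (g ** x) = conc_act g (T x)" if g: "g \<in> ?G" and x: "x \<in> ?U" for g x
  proof -
    let ?y = "rep x" and ?f = "frame x" and ?f' = "frame (g ** x)"
    have rep_eq: "rep (g ** x) = ?y" by (simp add: rep_def orbit[OF g])
    have f: "?f \<in> ?G" "?f ** ?y = x" using frame[OF x] by auto
    have f': "?f' \<in> ?G" "?f' ** ?y = g ** x" using frame[OF U[OF g x]] by (auto simp: rep_eq)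
    define s where "s = matrix_inv ?f' ** (g ** ?f)"
    have s: "s \<in> ?G"
      using g f f' by (simp add: s_def model_group_mult model_group_inv)
    have "s ** ?y = matrix_inv ?f' ** (?f' ** ?y)"
      by (simp add: s_def f f' flip: matrix_mul_assoc)
    then have "s ** ?y = ?y" using inv[OF f'(1)] by simp
    then have fixed: "conc_act s (\<kappa> ?y) = \<kappa> ?y"
      using \<kappa>(2) rep[OF x] s by blast
    have "?f' ** s = g ** ?f"
      using f' by (simp add: s_def matrix_mul_assoc matrix_inv_mult_right model_group_def)
    then have "conc_act ?f' (conc_act s (\<kappa> ?y)) = conc_act g (conc_act ?f (\<kappa> ?y))"
      using f f' g s by (metis conc_act_mult model_group_iff)
    then show ?thesis by (simp add: T_def rep_eq fixed)
  qed
  ultimately show ?thesis unfolding equivariant_estimator_on_def by blast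
qed

lemma exists_generic_equivariant_estimator:
  fixes E :: "'m::finite set set"
  assumes n: "\<And>i. card (down_set E i) \<le> CARD('n)"
  obtains Z :: "(real^'n^'m) set" and T where "generic_equivariant_estimator E Z T"
proof -
  let ?G = "model_group E"
  define p where "p x = (\<Prod>i\<in>UNIV. det (gram (down_set E i) x))" for x :: "real^'n^'m"
  have p: "p x \<noteq> 0 \<longleftrightarrow> x \<in> general_position E" for x
    by (simp add: p_def general_position_def det_gram_nonzero_iff)
  \<comment> \<open>Imposing the equation on all translates makes the set stable.\<close>
  define Z where "Z = {x. \<forall>g\<in>?G. p (g ** x) = 0}"
  have "real_algebraic_set Z"
    unfolding real_algebraic_set_def
  proof (intro exI conjI)
    show "\<forall>f\<in>(\<lambda>g x. p (g ** x)) ` ?G. real_polynomial_function f"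
      unfolding p_def by (auto intro!: real_polynomial_function_prod real_polynomial_function_det_gram)
    show "Z = {x. \<forall>f\<in>(\<lambda>g x. p (g ** x)) ` ?G. f x = 0}"
      by (simp add: Z_def)
  qed
  moreover have "Z \<subset> UNIV"
  proof -
    obtain x :: "real^'n^'m" where "\<And>D. card D \<le> CARD('n) \<Longrightarrow> independent_rows D x"
      using exists_independent_rows[where ?'n = 'n and ?'m = 'm] by blast
    then have "p (mat 1 ** x) \<noteq> 0" using n by (simp add: p general_position_def)
    then have "x \<notin> Z" using model_group_one[of E] unfolding Z_def by blast
    then show ?thesis by blast
  qed
  moreover have "stable_under ?G Z"
    by (auto simp: stable_under_def Z_def matrix_mul_assoc model_group_mult)
  moreover obtain T :: "real^'n^'m \<Rightarrow> real^'m^'m" where "equivariant_estimator_on E (UNIV - Z) T"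
  proof -
    have "\<exists>T. equivariant_estimator_on E
        {x :: real^'n^'m. \<exists>g\<in>?G. g ** x \<in> general_position E} T"
      by (intro equivariant_extension exists_fixed_pd_matrix finite_stabiliser)
    then obtain T :: "real^'n^'m \<Rightarrow> real^'m^'m"
      where "equivariant_estimator_on E {x. \<exists>g\<in>?G. g ** x \<in> general_position E} T" ..
    moreover have "{x. \<exists>g\<in>?G. g ** x \<in> general_position E} = UNIV - Z"
      unfolding Z_def p[symmetric] by blast
    ultimately show thesis using that by simp
  qed
  ultimately show thesis
    using that by (simp add: generic_equivariant_estimator_def)
qed

theorem theorem1p2:
  fixes E :: "'m::finite set set"
  assumes "simple_graph E"
  shows
    "((\<exists>(Z :: (real^'n::finite^'m) set) T. generic_equivariant_estimator E Z T) \<longleftrightarrow>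
        CARD('n) \<ge> (MAX i. card (down_set E i))) \<and>
     (CARD('n) \<ge> (MAX i. card (down_set E i)) \<longrightarrow>
        (\<exists>(Z :: (real^'n^'m) set) T.
           real_algebraic_set Z \<and> Z \<subset> UNIV \<and> stable_under (model_group E) Z \<and>
           equivariant_estimator_on E (UNIV - Z) T)) \<and>
     (CARD('n) < (MAX i. card (down_set E i)) \<longrightarrow>
        \<not> (\<exists>(U :: (real^'n^'m) set) T.
           U \<noteq> {} \<and> stable_under (model_group E) U \<and> equivariant_estimator_on E U T))"
proof -
  let ?max = "MAX i. card (down_set E i)"
  have exists: "\<exists>(Z :: (real^'n^'m) set) T. generic_equivariant_estimator E Z T"
    if "CARD('n) \<ge> ?max"
  proof -
    have "card (down_set E i) \<le> CARD('n)" for i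
      using that by (simp add: Max_le_iff)
    then show ?thesis using exists_generic_equivariant_estimator by metis
  qed
  have none: "\<not> equivariant_estimator_on E U T"
    if "CARD('n) < ?max" "U \<noteq> {}" for U :: "(real^'n^'m) set" and T
  proof -
    obtain i where "CARD('n) < card (down_set E i)"
      using \<open>CARD('n) < ?max\<close> by (auto simp: Max_gr_iff)
    then show ?thesis using no_equivariant_estimator \<open>U \<noteq> {}\<close> by blast
  qed
  have "?max \<le> CARD('n)"
    if gen: "generic_equivariant_estimator E Z T" for Z :: "(real^'n^'m) set" and T
  proof (rule ccontr)
    assume "\<not> ?max \<le> CARD('n)"
    moreover have "UNIV - Z \<noteq> {}" "equivariant_estimator_on E (UNIV - Z) T"
      using gen by (auto simp: generic_equivariant_estimator_def)
    ultimately show False using none not_le by blast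
  qed
  then show ?thesis
    using exists none unfolding generic_equivariant_estimator_def by blast
qed

end
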